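(* For every positive integer $t$ there is a graph $G$ such that $dis_{\ell}[G]-dis[G]\geq t$.
   Context: All graphs are finite, undirected, without loops or multiple edges. Natural numbers are positive integers. For a vertex $v$ of a graph $G$, $N[v]$ denotes the closed neighborhood of $v$ (i.e. $v$ together with its neighbors). A labeling $f$ of $V(G)$ by numbers is closed distinguishing if for any two adjacent vertices $u,v$ with $N[u]\neq N[v]$ we have $\sum_{w\in N[u]} f(w)\neq \sum_{w\in N[v]} f(w)$. The closed distinguishing number $dis[G]$ is the smallest positive integer $k$ such that $G$ has a closed distinguishing labeling $f:V(G)\to\{1,2,\ldots,k\}$. The graph $G$ is closed distinguishing $k$-choosable if for every assignment of lists $L(v)$ of $k$ natural numbers to the vertices $v$ of $G$, there is a closed distinguishing labeling $f$ of $G$ with $f(v)\in L(v)$ for each $v\in V(G)$. The closed distinguishing choice number $dis_{\ell}[G]$ is the minimum natural number $k$ such that $G$ is closed distinguishing $k$-choosable. *)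

theory Defs
  imports "Graph_Theory.Pair_Digraph"
begin

text \<open>
  A finite simple undirected graph is a \<^locale>\<open>pair_graph\<close>: finitely many vertices and a
  symmetric, loop-free adjacency relation on them. Labels are taken from
  the positive elements of \<^typ>\<open>nat\<close>.
\<close>

definition closed_nbhd :: "'a pair_pre_digraph \<Rightarrow> 'a \<Rightarrow> 'a set" where
  "closed_nbhd G v = insert v {u. (v, u) \<in> parcs G}"

definition closed_distinguishing :: "'a pair_pre_digraph \<Rightarrow> ('a \<Rightarrow> nat) \<Rightarrow> bool" where
  "closed_distinguishing G f \<longleftrightarrow>
     (\<forall>u v. (u, v) \<in> parcs G \<and> closed_nbhd G u \<noteq> closed_nbhd G v \<longrightarrow>
        (\<Sum>w\<in>closed_nbhd G u. f w) \<noteq> (\<Sum>w\<in>closed_nbhd G v. f w))"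

text \<open>
  The sets minimised over below are nonempty for every \<^const>\<open>pair_graph\<close>. Distinct powers of two
  give a closed distinguishing labeling. If all lists have more than \<open>n\<^sup>2\<close> elements, where
  \<open>n\<close> is the number of vertices, labels can be chosen greedily in any order of the vertices:
  each edge forbids at most one value, at the last vertex in the symmetric difference of the
  closed neighborhoods of its ends.
\<close>

definition dis :: "'a pair_pre_digraph \<Rightarrow> nat" where
  "dis G = (LEAST k. k \<ge> 1 \<and>
     (\<exists>f. (\<forall>v\<in>pverts G. f v \<in> {1..k}) \<and> closed_distinguishing G f))"

text \<open>A list of size \<open>k\<close> is a set of \<open>k\<close> distinct admissible labels.\<close>

definition closed_distinguishing_choosable :: "'a pair_pre_digraph \<Rightarrow> nat \<Rightarrow> bool" where
  "closed_distinguishing_choosable G k \<longleftrightarrow>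
     (\<forall>L :: 'a \<Rightarrow> nat set.
        (\<forall>v\<in>pverts G. finite (L v) \<and> card (L v) = k \<and> L v \<subseteq> {1..}) \<longrightarrow>
        (\<exists>f. (\<forall>v\<in>pverts G. f v \<in> L v) \<and> closed_distinguishing G f))"

definition dis_choice :: "'a pair_pre_digraph \<Rightarrow> nat" where
  "dis_choice G = (LEAST k. k \<ge> 1 \<and> closed_distinguishing_choosable G k)"

end

theory Submission
  imports Defs "HOL-Library.Nat_Bijection" "HOL-Library.Countable"
begin

text \<open>
  Subdividing every edge of a graph \<open>H\<close> twice turns an edge \<open>ab\<close> into a path \<open>a, u, v, b\<close>. The
  closed neighborhoods of \<open>u\<close> and \<open>v\<close> differ only in \<open>a\<close> and \<open>b\<close>, so a closed distinguishing
  labeling restricts to a proper colouring of \<open>H\<close>. Take \<open>H\<close> complete bipartite, with \<open>k\<close> vertices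
  on the left and the \<open>k\<close>-subsets of \<open>{1..k\<^sup>2}\<close> on the right. Left lists that partition
  \<open>{1..k\<^sup>2}\<close>, with each set \<open>S\<close> on the right having list \<open>S\<close>, admit no proper colouring: the
  colours chosen on the left form a vertex on the right. On the other hand two labels suffice,
  since \<open>H\<close> is bipartite.
\<close>

section \<open>Choosability with long lists\<close>

text \<open>The label of the newly inserted vertex \<open>x\<close> is chosen last. A pair in
  \<open>E\<close> with \<open>x\<close> in exactly one of its two sets rules out at most one value
  for it, and a list longer than \<open>card E\<close> leaves a value over.\<close>

lemma exists_labeling_sums_differ:
  fixes L :: "'a \<Rightarrow> nat set"
  assumes "finite V" "finite E" "\<And>A B. (A, B) \<in> E \<Longrightarrow> A \<subseteq> V \<and> B \<subseteq> V \<and> A \<noteq> B"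
    and "\<And>v. v \<in> V \<Longrightarrow> finite (L v) \<and> card E < card (L v)"
  shows "\<exists>f. (\<forall>v\<in>V. f v \<in> L v) \<and> (\<forall>(A, B)\<in>E. sum f A \<noteq> sum f B)"
  using assms
proof (induction V arbitrary: E rule: finite_induct)
  case empty
  have "p \<notin> E" for p using empty(2)[of "fst p" "snd p"] by auto
  then have "E = {}" by blast
  then show ?case by simp
next
  case (insert x V)
  let ?r = "\<lambda>(A, B). (A - {x}, B - {x})"
  \<comment> \<open>For a pair with \<open>x\<close> in both sets or in neither, the label of
    \<open>x\<close> does not affect whether the sums differ. Such pairs go to the induction
    hypothesis with \<open>x\<close> erased, which keeps the two sets distinct.\<close>
  define E' where "E' = ?r ` {p \<in> E. x \<in> fst p \<longleftrightarrow> x \<in> snd p}"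
  have "card E' \<le> card {p \<in> E. x \<in> fst p \<longleftrightarrow> x \<in> snd p}"
    unfolding E'_def using insert.prems(1) by (intro card_image_le) auto
  also have "\<dots> \<le> card E" using insert.prems(1) by (intro card_mono) auto
  finally have card: "card E' \<le> card E" .
  have "\<exists>f. (\<forall>v\<in>V. f v \<in> L v) \<and> (\<forall>(A, B)\<in>E'. sum f A \<noteq> sum f B)"
  proof (rule insert.IH)
    show "finite E'" unfolding E'_def using insert.prems(1) by auto
    show "finite (L v) \<and> card E' < card (L v)" if "v \<in> V" for v
      using insert.prems(3)[of v] that card by auto
    fix A B assume "(A, B) \<in> E'"
    then obtain C D where CD: "(C, D) \<in> E" "x \<in> C \<longleftrightarrow> x \<in> D" "A = C - {x}" "B = D - {x}"
      unfolding E'_def by auto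
    then show "A \<subseteq> V \<and> B \<subseteq> V \<and> A \<noteq> B" using insert.prems(2)[OF CD(1)] by blast
  qed
  then obtain f where f: "\<forall>v\<in>V. f v \<in> L v" "\<And>A B. (A, B) \<in> E' \<Longrightarrow> sum f A \<noteq> sum f B"
    by blast
  \<comment> \<open>If \<open>x\<close> is in exactly one of the sets, this is the only label of
    \<open>x\<close> that could make the sums equal. When the subtraction truncates, no label does,
    and excluding 0 is harmless. For the remaining pairs the value is arbitrary; it only keeps the
    count at one per pair.\<close>
  define forbidden where "forbidden A B =
    (if x \<in> A then sum f B - sum f (A - {x}) else sum f A - sum f (B - {x}))" for A B
  define bad where "bad = (\<lambda>(A, B). forbidden A B) ` E"
  have "card bad \<le> card E" unfolding bad_def using insert.prems(1) by (rule card_image_le)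
  then have "card bad < card (L x)" using insert.prems(3)[of x] by auto
  moreover have "finite bad" unfolding bad_def using insert.prems(1) by auto
  ultimately have "\<not> L x \<subseteq> bad" by (meson card_mono not_less)
  then obtain y where y: "y \<in> L x" "y \<notin> bad" by blast
  let ?g = "f(x := y)"
  have out: "sum ?g A = sum f A" if "x \<notin> A" for A
    using that by (intro sum.cong) auto
  have fin: "finite A" if "A \<subseteq> insert x V" for A
    using that insert.hyps(1) finite_subset by auto
  have inn: "sum ?g A = y + sum f (A - {x})" if "x \<in> A" "A \<subseteq> insert x V" for A
    using sum.remove[OF fin[OF that(2)] that(1), of ?g] out[of "A - {x}"] by simp
  have "sum ?g A \<noteq> sum ?g B" if AB: "(A, B) \<in> E" for A B
  proof -
    have sub: "A \<subseteq> insert x V" "B \<subseteq> insert x V" using insert.prems(2)[OF AB] by auto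
    have "forbidden A B \<in> bad"
      unfolding bad_def using AB by (intro image_eqI[where x = "(A, B)"]) auto
    then have nb: "y \<noteq> forbidden A B" using y(2) by blast
    show ?thesis
    proof (cases "x \<in> A \<longleftrightarrow> x \<in> B")
      case True
      then have "(A - {x}, B - {x}) \<in> E'" 
        unfolding E'_def using AB by (intro image_eqI[where x = "(A, B)"]) auto
      then have *: "sum f (A - {x}) \<noteq> sum f (B - {x})" by (rule f(2))
      then show ?thesis using True inn[OF _ sub(1)] inn[OF _ sub(2)] out[of A] out[of B]
        by (cases "x \<in> A") auto
    next
      case False
      then show ?thesis using nb inn[OF _ sub(1)] inn[OF _ sub(2)] out[of A] out[of B]
        by (cases "x \<in> A") (auto simp: forbidden_def)
    qed
  qed
  moreover have "\<forall>v\<in>insert x V. ?g v \<in> L v" using f(1) y(1) by auto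
  ultimately show ?case by blast
qed

lemma (in pair_fin_digraph) closed_nbhd_subset: "v \<in> pverts G \<Longrightarrow> closed_nbhd G v \<subseteq> pverts G"
  unfolding closed_nbhd_def using in_arcsD2 by auto

text \<open>This ensures that the minimum defining \<open>dis_choice\<close> is attained. The pairs
  to separate are the distinct closed neighborhoods of adjacent vertices, and lists of size
  \<open>Suc (card E)\<close> are long enough.\<close>

lemma (in pair_fin_digraph) exists_choosable:
  "\<exists>k\<ge>1. closed_distinguishing_choosable G k"
proof -
  define E where "E = (\<lambda>(u, v). (closed_nbhd G u, closed_nbhd G v)) `
    {(u, v) \<in> parcs G. closed_nbhd G u \<noteq> closed_nbhd G v}"
  have "finite {(u, v) \<in> parcs G. closed_nbhd G u \<noteq> closed_nbhd G v}"
    by (rule finite_subset[OF _ pair_finite_arcs]) auto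
  then have fin: "finite E" unfolding E_def by simp
  have "\<exists>f. (\<forall>v\<in>pverts G. f v \<in> L v) \<and> closed_distinguishing G f"
    if L: "\<forall>v\<in>pverts G. finite (L v) \<and> card (L v) = Suc (card E) \<and> L v \<subseteq> {1..}" for L
  proof -
    have "\<exists>f. (\<forall>v\<in>pverts G. f v \<in> L v) \<and> (\<forall>(A, B)\<in>E. sum f A \<noteq> sum f B)"
    proof (rule exists_labeling_sums_differ[OF pair_finite_verts fin])
      fix A B assume "(A, B) \<in> E"
      then obtain u v where uv: "(u, v) \<in> parcs G" "closed_nbhd G u \<noteq> closed_nbhd G v"
          "A = closed_nbhd G u" "B = closed_nbhd G v"
        unfolding E_def by auto
      then show "A \<subseteq> pverts G \<and> B \<subseteq> pverts G \<and> A \<noteq> B"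
        using closed_nbhd_subset[OF in_arcsD1[OF uv(1)]] closed_nbhd_subset[OF in_arcsD2[OF uv(1)]]
        by simp
    qed (use L in auto)
    then obtain f where f: "\<forall>v\<in>pverts G. f v \<in> L v"
      "\<And>A B. (A, B) \<in> E \<Longrightarrow> sum f A \<noteq> sum f B"
      by blast
    have "closed_distinguishing G f"
      unfolding closed_distinguishing_def
      by (intro allI impI f(2)) (auto simp: E_def)
    with f(1) show ?thesis by blast
  qed
  then have "closed_distinguishing_choosable G (Suc (card E))"
    unfolding closed_distinguishing_choosable_def by blast
  then show ?thesis by (intro exI[of _ "Suc (card E)"]) simp
qed

text \<open>Each list of size \<open>k\<close> can be shrunk to a sublist of size
  \<open>j\<close>.\<close>

lemma closed_distinguishing_choosable_mono:
  assumes "closed_distinguishing_choosable G j" "j \<le> k"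
  shows "closed_distinguishing_choosable G k"
  unfolding closed_distinguishing_choosable_def
proof (intro allI impI)
  fix L :: "'a \<Rightarrow> nat set"
  assume L: "\<forall>v\<in>pverts G. finite (L v) \<and> card (L v) = k \<and> L v \<subseteq> {1..}"
  have "\<forall>v\<in>pverts G. \<exists>M. M \<subseteq> L v \<and> card M = j \<and> finite M"
  proof
    fix v assume "v \<in> pverts G"
    then have "j \<le> card (L v)" using L assms(2) by auto
    then show "\<exists>M. M \<subseteq> L v \<and> card M = j \<and> finite M"
      by (rule obtain_subset_with_card_n) blast
  qed
  then obtain M where M: "\<And>v. v \<in> pverts G \<Longrightarrow> M v \<subseteq> L v \<and> card (M v) = j \<and> finite (M v)"
    by metis
  then have "\<forall>v\<in>pverts G. finite (M v) \<and> card (M v) = j \<and> M v \<subseteq> {1..}"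
    using L by blast
  then obtain f where "\<forall>v\<in>pverts G. f v \<in> M v" "closed_distinguishing G f"
    using assms(1) unfolding closed_distinguishing_choosable_def by blast
  with M show "\<exists>f. (\<forall>v\<in>pverts G. f v \<in> L v) \<and> closed_distinguishing G f" by blast
qed

text \<open>By monotonicity, failure at \<open>k\<close> excludes every smaller list size too, while
  the size \<open>dis_choice G\<close> itself succeeds.\<close>

lemma (in pair_fin_digraph) dis_choice_greater:
  assumes "\<not> closed_distinguishing_choosable G k"
  shows "k < dis_choice G"
proof -
  have "closed_distinguishing_choosable G (dis_choice G)"
    unfolding dis_choice_def using LeastI_ex[OF exists_choosable] by blast
  with assms show ?thesis
    using closed_distinguishing_choosable_mono not_less by blast
qed

section \<open>Relabeling vertices\<close>

lemma pair_graphI: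
  assumes "finite (pverts G)" "\<And>u v. (u, v) \<in> parcs G \<Longrightarrow> u \<in> pverts G"
    "\<And>u v. (u, v) \<in> parcs G \<Longrightarrow> (v, u) \<in> parcs G \<and> u \<noteq> v"
  shows "pair_graph G"
proof -
  have sub: "parcs G \<subseteq> pverts G \<times> pverts G"
  proof
    fix e assume "e \<in> parcs G"
    then have "(fst e, snd e) \<in> parcs G" by simp
    \<comment> \<open>The second endpoint is the first endpoint of the reversed arc.\<close>
    then show "e \<in> pverts G \<times> pverts G" using assms(2,3) by (metis mem_Times_iff)
  qed
  have no_loop: "fst e \<noteq> snd e" if "e \<in> parcs G" for e
    using assms(3)[of "fst e" "snd e"] that by simp
  from sub have "finite (parcs G)" using assms(1) by (meson finite_SigmaI finite_subset)
  moreover have "symmetric (with_proj G)"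
    unfolding symmetric_def with_proj_simps using assms(3) by (intro symI) blast
  ultimately show ?thesis using assms(1) sub no_loop
    by unfold_locales (auto simp: mem_Times_iff)
qed

text \<open>Serves to move the construction from a sum type to vertices in \<open>nat\<close>;
  \<open>h\<close> is injective wherever this is used.\<close>

definition relabel :: "('a \<Rightarrow> 'b) \<Rightarrow> 'a pair_pre_digraph \<Rightarrow> 'b pair_pre_digraph" where
  "relabel h G = \<lparr>pverts = h ` pverts G, parcs = map_prod h h ` parcs G\<rparr>"

lemma pair_graph_relabel:
  assumes "inj h" "pair_graph G"
  shows "pair_graph (relabel h G)"
proof -
  interpret pair_graph G by fact
  show ?thesis
  proof (rule pair_graphI)
    show "finite (pverts (relabel h G))" using pair_finite_verts by (simp add: relabel_def)
    fix u v assume "(u, v) \<in> parcs (relabel h G)"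
    then obtain a b where ab: "u = h a" "v = h b" "(a, b) \<in> parcs G"
      unfolding relabel_def by auto
    show "u \<in> pverts (relabel h G)" using ab in_arcsD1[OF ab(3)] by (simp add: relabel_def)
    show "(v, u) \<in> parcs (relabel h G) \<and> u \<noteq> v"
      using ab arcs_symmetric[OF ab(3)] no_loops'[OF ab(3)] inj_eq[OF assms(1)]
      by (auto simp: relabel_def)
  qed
qed

lemma closed_nbhd_relabel:
  assumes "inj h"
  shows "closed_nbhd (relabel h G) (h v) = h ` closed_nbhd G v"
proof -
  have "(h v, w) \<in> parcs (relabel h G) \<longleftrightarrow> (\<exists>u. w = h u \<and> (v, u) \<in> parcs G)" for w
    unfolding relabel_def using injD[OF assms] by fastforce
  then show ?thesis unfolding closed_nbhd_def by auto
qed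

text \<open>An injective \<open>h\<close> carries closed neighborhoods to closed neighborhoods, so
  sums are reindexed and distinct neighborhoods stay distinct.\<close>

lemma closed_distinguishing_relabel:
  assumes "inj h"
  shows "closed_distinguishing (relabel h G) f \<longleftrightarrow> closed_distinguishing G (f \<circ> h)"
proof -
  have sum: "sum f (closed_nbhd (relabel h G) (h v)) = sum (f \<circ> h) (closed_nbhd G v)" for v
    unfolding closed_nbhd_relabel[OF assms] using assms
    by (intro sum.reindex) (auto intro: inj_on_subset)
  have ne: "closed_nbhd (relabel h G) (h u) \<noteq> closed_nbhd (relabel h G) (h v) \<longleftrightarrow>
      closed_nbhd G u \<noteq> closed_nbhd G v" for u v
    unfolding closed_nbhd_relabel[OF assms] by (simp add: inj_image_eq_iff[OF assms])
  have "closed_distinguishing (relabel h G) f \<longleftrightarrow> (\<forall>u v. (u, v) \<in> parcs G \<longrightarrow>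
      closed_nbhd (relabel h G) (h u) \<noteq> closed_nbhd (relabel h G) (h v) \<longrightarrow>
      sum f (closed_nbhd (relabel h G) (h u)) \<noteq> sum f (closed_nbhd (relabel h G) (h v)))"
    unfolding closed_distinguishing_def by (auto simp: relabel_def)
  also have "\<dots> \<longleftrightarrow> closed_distinguishing G (f \<circ> h)"
    unfolding closed_distinguishing_def ne sum by blast
  finally show ?thesis .
qed

text \<open>Lists are transported along \<open>inv h\<close> and the resulting labeling is pulled
  back along \<open>h\<close>. In contrapositive form, a failure of choosability survives
  relabeling.\<close>

lemma closed_distinguishing_choosable_relabel:
  assumes "inj h" "closed_distinguishing_choosable (relabel h G) k"
  shows "closed_distinguishing_choosable G k"
  unfolding closed_distinguishing_choosable_def
proof (intro allI impI)
  fix L :: "'a \<Rightarrow> nat set"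
  assume "\<forall>v\<in>pverts G. finite (L v) \<and> card (L v) = k \<and> L v \<subseteq> {1..}"
  then have "\<forall>v\<in>pverts (relabel h G).
      finite ((L \<circ> inv h) v) \<and> card ((L \<circ> inv h) v) = k \<and> (L \<circ> inv h) v \<subseteq> {1..}"
    by (auto simp: relabel_def inv_f_f[OF assms(1)])
  then obtain f where f: "\<forall>v\<in>pverts (relabel h G). f v \<in> (L \<circ> inv h) v"
      "closed_distinguishing (relabel h G) f"
    using assms(2) unfolding closed_distinguishing_choosable_def by blast
  have "\<forall>v\<in>pverts G. (f \<circ> h) v \<in> L v"
    using f(1) by (auto simp: relabel_def inv_f_f[OF assms(1)])
  with f(2) show "\<exists>f. (\<forall>v\<in>pverts G. f v \<in> L v) \<and> closed_distinguishing G f"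
    using closed_distinguishing_relabel[OF assms(1)] by blast
qed

lemma dis_relabel:
  assumes "inj h"
  shows "dis (relabel h G) = dis G"
proof -
  have "(\<exists>f. (\<forall>v\<in>pverts (relabel h G). f v \<in> {1..k}) \<and> closed_distinguishing (relabel h G) f) \<longleftrightarrow>
      (\<exists>f. (\<forall>v\<in>pverts G. f v \<in> {1..k}) \<and> closed_distinguishing G f)" (is "?l \<longleftrightarrow> ?r") for k
  proof
    assume ?l
    then obtain f where "\<forall>v\<in>pverts (relabel h G). f v \<in> {1..k}"
        "closed_distinguishing (relabel h G) f"
      by blast
    then show ?r
      unfolding closed_distinguishing_relabel[OF assms]
      by (intro exI[of _ "f \<circ> h"]) (auto simp: relabel_def)
  next
    assume ?r
    then obtain f where f: "\<forall>v\<in>pverts G. f v \<in> {1..k}" "closed_distinguishing G f"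
      by blast
    have "f \<circ> inv h \<circ> h = f" by (simp add: comp_assoc inv_o_cancel[OF assms])
    with f show ?l
      unfolding closed_distinguishing_relabel[OF assms]
      by (intro exI[of _ "f \<circ> inv h"]) (auto simp: relabel_def inv_f_f[OF assms])
  qed
  then show ?thesis unfolding dis_def by simp
qed

section \<open>Subdividing every edge twice\<close>

text \<open>On the path replacing the edge \<open>ab\<close>, the vertex next to \<open>Inl a\<close> is \<open>Inr (a, b)\<close>.\<close>

definition subdivide_twice :: "'a pair_pre_digraph \<Rightarrow> ('a + 'a \<times> 'a) pair_pre_digraph" where
  "subdivide_twice H = \<lparr>pverts = Inl ` pverts H \<union> Inr ` parcs H,
     parcs = {(Inl a, Inr (a, b)) | a b. (a, b) \<in> parcs H} \<union>
             {(Inr (a, b), Inl a) | a b. (a, b) \<in> parcs H} \<union>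
             {(Inr (a, b), Inr (b, a)) | a b. (a, b) \<in> parcs H}\<rparr>"

context pair_graph
begin

lemma pair_graph_subdivide_twice: "pair_graph (subdivide_twice G)"
proof (rule pair_graphI)
  show "finite (pverts (subdivide_twice G))"
    by (simp add: subdivide_twice_def)
next
  fix u v assume "(u, v) \<in> parcs (subdivide_twice G)"
  then obtain a b where ab: "(a, b) \<in> parcs G" and
    uv: "(u, v) = (Inl a, Inr (a, b)) \<or> (u, v) = (Inr (a, b), Inl a) \<or> (u, v) = (Inr (a, b), Inr (b, a))"
    unfolding subdivide_twice_def by auto
  show "u \<in> pverts (subdivide_twice G)"
    using uv ab in_arcsD1[OF ab] by (auto simp: subdivide_twice_def)
  have "(Inl a, Inr (a, b)) \<in> parcs (subdivide_twice G)" "(Inr (a, b), Inl a) \<in> parcs (subdivide_twice G)"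
    "(Inr (b, a), Inr (a, b)) \<in> parcs (subdivide_twice G)"
    using ab arcs_symmetric[OF ab] by (simp_all add: subdivide_twice_def)
  then show "(v, u) \<in> parcs (subdivide_twice G) \<and> u \<noteq> v"
    using uv no_loops'[OF ab] by auto
qed

lemma closed_nbhd_subdivide_twice_Inl:
  "closed_nbhd (subdivide_twice G) (Inl a) = insert (Inl a) (Inr ` Pair a ` {b. (a, b) \<in> parcs G})"
  unfolding closed_nbhd_def subdivide_twice_def by auto

lemma closed_nbhd_subdivide_twice_Inr:
  assumes "(a, b) \<in> parcs G"
  shows "closed_nbhd (subdivide_twice G) (Inr (a, b)) = {Inl a, Inr (a, b), Inr (b, a)}"
  unfolding closed_nbhd_def subdivide_twice_def using assms by auto

lemma proper_of_closed_distinguishing_subdivide_twice: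
  assumes "closed_distinguishing (subdivide_twice G) f" "(a, b) \<in> parcs G"
  shows "f (Inl a) \<noteq> f (Inl b)"
proof -
  have ba: "(b, a) \<in> parcs G" by (rule arcs_symmetric[OF assms(2)])
  have ne: "a \<noteq> b" by (rule no_loops'[OF assms(2)])
  note N = closed_nbhd_subdivide_twice_Inr[OF assms(2)] closed_nbhd_subdivide_twice_Inr[OF ba]
  have "(Inr (a, b), Inr (b, a)) \<in> parcs (subdivide_twice G)"
    using assms(2) by (simp add: subdivide_twice_def)
  moreover have "closed_nbhd (subdivide_twice G) (Inr (a, b)) \<noteq> closed_nbhd (subdivide_twice G) (Inr (b, a))"
  proof -
    have "Inl a \<in> closed_nbhd (subdivide_twice G) (Inr (a, b))"
      "Inl a \<notin> closed_nbhd (subdivide_twice G) (Inr (b, a))"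
      unfolding N using ne by simp_all
    then show ?thesis by blast
  qed
  ultimately have "sum f {Inl a, Inr (a, b), Inr (b, a)} \<noteq> sum f {Inl b, Inr (b, a), Inr (a, b)}"
    using assms(1) unfolding closed_distinguishing_def N[symmetric] by blast
  \<comment> \<open>The labels of the two inner vertices of the path occur in both sums and
    cancel.\<close>
  then show ?thesis using ne by auto
qed

text \<open>
  Labeling each vertex \<open>Inr (a, b)\<close> like \<open>Inl a\<close>, the edge from \<open>Inl a\<close> to \<open>Inr (a, b)\<close> requires
  \<open>d * c a \<noteq> c a + c b = 3\<close>, where \<open>d\<close> is the degree of \<open>a\<close>.
\<close>

lemma dis_subdivide_twice_le_2:
  assumes c: "\<And>a. c a \<in> {1, 2::nat}" "\<And>a b. (a, b) \<in> parcs G \<Longrightarrow> c a \<noteq> c b"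
    and deg: "\<And>a. a \<in> pverts G \<Longrightarrow> c a = 1 \<Longrightarrow> card {b. (a, b) \<in> parcs G} \<noteq> 3"
  shows "dis (subdivide_twice G) \<le> 2"
proof -
  define f where "f = (\<lambda>x :: 'a + 'a \<times> 'a. case x of Inl a \<Rightarrow> c a | Inr p \<Rightarrow> c (fst p))"
  have Inr_sum: "sum f (closed_nbhd (subdivide_twice G) (Inr (a, b))) = c a + c a + c b"
    if "(a, b) \<in> parcs G" for a b
  proof -
    have "a \<noteq> b" by (rule no_loops'[OF that])
    then show ?thesis unfolding closed_nbhd_subdivide_twice_Inr[OF that] by (auto simp: f_def)
  qed
  have Inl_sum: "sum f (closed_nbhd (subdivide_twice G) (Inl a)) = c a + card {b. (a, b) \<in> parcs G} * c a"
    for a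
  proof -
    have fin: "finite {b. (a, b) \<in> parcs G}"
      by (rule finite_subset[OF _ finite_imageI[OF pair_finite_arcs, of snd]]) force
    have "sum f (Inr ` Pair a ` {b. (a, b) \<in> parcs G}) = (\<Sum>b | (a, b) \<in> parcs G. c a)"
      unfolding image_image by (subst sum.reindex) (auto simp: inj_on_def f_def)
    then show ?thesis
      unfolding closed_nbhd_subdivide_twice_Inl using fin
      by (subst sum.insert) (auto simp: f_def)
  qed
  have edge: "sum f (closed_nbhd (subdivide_twice G) (Inl a)) \<noteq> sum f (closed_nbhd (subdivide_twice G) (Inr (a, b)))"
    if ab: "(a, b) \<in> parcs G" for a b
  proof -
    have "c a + c b = 3" using c(1)[of a] c(1)[of b] c(2)[OF ab] by auto
    \<comment> \<open>Colour 1 would need degree 3, which \<open>deg\<close> excludes; colour 2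
      makes the product even.\<close>
    moreover have "card {b. (a, b) \<in> parcs G} * c a \<noteq> 3"
    proof (cases "c a = 1")
      case True
      then show ?thesis using deg in_arcsD1[OF ab] by auto
    next
      case False
      then have "c a = 2" using c(1)[of a] by auto
      then show ?thesis by presburger
    qed
    ultimately show ?thesis unfolding Inr_sum[OF ab] Inl_sum by linarith
  qed
  have "closed_distinguishing (subdivide_twice G) f"
    unfolding closed_distinguishing_def
  proof (intro allI impI, elim conjE)
    fix u v assume "(u, v) \<in> parcs (subdivide_twice G)"
    then consider a b where "(a, b) \<in> parcs G" "u = Inl a" "v = Inr (a, b)"
      | a b where "(a, b) \<in> parcs G" "u = Inr (a, b)" "v = Inl a"
      | a b where "(a, b) \<in> parcs G" "u = Inr (a, b)" "v = Inr (b, a)"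
      unfolding subdivide_twice_def by auto
    then show "sum f (closed_nbhd (subdivide_twice G) u) \<noteq> sum f (closed_nbhd (subdivide_twice G) v)"
    proof cases
      case (1 a b) then show ?thesis using edge[OF 1(1)] by simp
    next
      case (2 a b) then show ?thesis using not_sym[OF edge[OF 2(1)]] by simp
    next
      case (3 a b)
      then have "(b, a) \<in> parcs G" using arcs_symmetric by blast
      \<comment> \<open>The sums \<open>2 * c a + c b\<close> and \<open>2 * c b + c a\<close>
        differ exactly when \<open>c a\<close> and \<open>c b\<close> do.\<close>
      then show ?thesis using 3 Inr_sum c(2)[of a b] by simp
    qed
  qed
  moreover have "f v \<in> {1..2}" for v
  proof -
    obtain a where "f v = c a" by (cases v) (simp_all add: f_def)
    then show ?thesis using c(1)[of a] by auto
  qed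
  ultimately show ?thesis unfolding dis_def by (intro Least_le) auto
qed

end

section \<open>A bipartite graph that is not k-choosable\<close>

text \<open>Coding finite sets by \<open>set_encode\<close> gives both sides of the bipartite graph
  the vertex type \<open>nat\<close>; \<open>set_decode\<close> recovers the subset.\<close>

definition right_part :: "nat \<Rightarrow> nat set" where
  "right_part k = set_encode ` {S. S \<subseteq> {1..k * k} \<and> card S = k}"

definition bip :: "nat \<Rightarrow> (nat + nat) pair_pre_digraph" where
  "bip k = \<lparr>pverts = Inl ` {..<k} \<union> Inr ` right_part k,
     parcs = (Inl ` {..<k}) \<times> (Inr ` right_part k) \<union> (Inr ` right_part k) \<times> (Inl ` {..<k})\<rparr>"

lemma pair_graph_bip: "pair_graph (bip k)"
proof -
  have "finite (right_part k)" unfolding right_part_def by simp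
  then show ?thesis by (intro pair_graphI) (auto simp: bip_def)
qed

text \<open>Left vertices get colour 2 and right vertices colour 1. The forbidden degree 3 concerns
  only colour 1, and right vertices have degree \<open>k\<close>.\<close>

lemma dis_subdivide_twice_bip:
  assumes "k \<noteq> 3"
  shows "dis (subdivide_twice (bip k)) \<le> 2"
proof (rule pair_graph.dis_subdivide_twice_le_2[OF pair_graph_bip, where c = "case_sum (\<lambda>_. 2) (\<lambda>_. 1)"])
  fix a assume "a \<in> pverts (bip k)" "case_sum (\<lambda>_. 2) (\<lambda>_. 1) a = (1 :: nat)"
  then have "{b. (a, b) \<in> parcs (bip k)} = Inl ` {..<k}" by (auto simp: bip_def)
  then show "card {b. (a, b) \<in> parcs (bip k)} \<noteq> 3" using assms by (simp add: card_image)
qed (auto simp: bip_def split: sum.split)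

lemma not_choosable_subdivide_twice_bip:
  "\<not> closed_distinguishing_choosable (subdivide_twice (bip k)) k"
proof
  assume choosable: "closed_distinguishing_choosable (subdivide_twice (bip k)) k"
  \<comment> \<open>The left lists are consecutive blocks of length \<open>k\<close>. The inner
    vertices of the paths may have any list of size \<open>k\<close>, since their labels
    cancel.\<close>
  define L where "L = (\<lambda>x. case x of Inl (Inl i) \<Rightarrow> {i * k + 1..i * k + k}
    | Inl (Inr m) \<Rightarrow> set_decode m | Inr (_ :: (nat + nat) \<times> (nat + nat)) \<Rightarrow> {1..k})"
  have "finite (L v) \<and> card (L v) = k \<and> L v \<subseteq> {1..}" if "v \<in> pverts (subdivide_twice (bip k))" for v
  proof -
    consider i where "v = Inl (Inl i)" | m where "v = Inl (Inr m)" "m \<in> right_part k"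
      | p where "v = Inr p"
      using \<open>v \<in> _\<close> unfolding subdivide_twice_def bip_def by auto
    then show ?thesis
    proof cases
      case (2 m)
      then obtain S where S: "m = set_encode S" "S \<subseteq> {1..k * k}" "card S = k"
        unfolding right_part_def by blast
      have "finite S" using S(2) by (rule finite_subset) simp
      moreover from this have "L v = S" using 2(1) S(1) by (simp add: L_def)
      moreover have "S \<subseteq> {1..}" using S(2) by auto
      ultimately show ?thesis using S(3) by simp
    qed (auto simp: L_def)
  qed
  then have "\<forall>v\<in>pverts (subdivide_twice (bip k)). finite (L v) \<and> card (L v) = k \<and> L v \<subseteq> {1..}"
    by (rule ballI)
  with spec[OF choosable[unfolded closed_distinguishing_choosable_def], of L]
  have "\<exists>f. (\<forall>v\<in>pverts (subdivide_twice (bip k)). f v \<in> L v) \<and>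
      closed_distinguishing (subdivide_twice (bip k)) f"
    by (rule mp)
  then obtain f where f: "\<And>v. v \<in> pverts (subdivide_twice (bip k)) \<Longrightarrow> f v \<in> L v"
      "closed_distinguishing (subdivide_twice (bip k)) f"
    by (elim exE conjE) (rule that, simp_all)
  define g where "g i = f (Inl (Inl i))" for i
  have g: "i * k < g i \<and> g i \<le> i * k + k" if "i < k" for i
    using f(1)[of "Inl (Inl i)"] that by (force simp: subdivide_twice_def bip_def L_def g_def)
  define S where "S = g ` {..<k}"
  \<comment> \<open>The value \<open>g i\<close> lies in block number \<open>i\<close>, and the
    blocks are disjoint and increasing. Hence the \<open>k\<close> left labels are distinct and
    \<open>S\<close> has exactly \<open>k\<close> elements.\<close>
  have "g i < g j" if "i < j" "j < k" for i j
  proof -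
    have "Suc i * k \<le> j * k" using that by (intro mult_right_mono) auto
    then show ?thesis using g[of i] g[of j] that by auto
  qed
  then have "inj_on g {..<k}"
    by (metis inj_onI lessThan_iff less_irrefl nat_neq_iff)
  then have "card S = k" unfolding S_def by (simp add: card_image)
  moreover have "S \<subseteq> {1..k * k}"
  proof -
    have "g i \<in> {1..k * k}" if "i < k" for i
    proof -
      have "Suc i * k \<le> k * k" using that by (intro mult_right_mono) auto
      then show ?thesis using g[OF that] by auto
    qed
    then show ?thesis unfolding S_def by auto
  qed
  ultimately have right: "set_encode S \<in> right_part k" unfolding right_part_def by blast
  have "finite S" unfolding S_def by simp
  \<comment> \<open>The right vertex coded by \<open>S\<close> has list \<open>S\<close>, so its
    label repeats that of some left vertex, to which it is adjacent.\<close>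
  then have "f (Inl (Inr (set_encode S))) \<in> S"
    using f(1)[of "Inl (Inr (set_encode S))"] right
    by (simp add: subdivide_twice_def bip_def L_def)
  then obtain i where i: "i < k" "f (Inl (Inr (set_encode S))) = f (Inl (Inl i))"
    unfolding S_def g_def by auto
  have "(Inl i, Inr (set_encode S)) \<in> parcs (bip k)" using i(1) right unfolding bip_def by simp
  from pair_graph.proper_of_closed_distinguishing_subdivide_twice[OF pair_graph_bip f(2) this] i(2)
  show False by simp
qed

theorem theorem1:
  fixes t :: nat
  assumes "t \<ge> 1"
  shows "\<exists>G :: nat pair_pre_digraph. pair_graph G \<and> int (dis_choice G) - int (dis G) \<ge> int t"
proof -
  \<comment> \<open>Failure at \<open>t + 3\<close> against two labels gives a gap of at least
    \<open>t + 2\<close>. As \<open>t\<close> is positive, \<open>t + 3\<close> also avoids the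
    excluded degree 3.\<close>
  define H where "H = subdivide_twice (bip (t + 3))"
  define G where "G = relabel to_nat H"
  have inj: "inj (to_nat :: (nat + nat) + (nat + nat) \<times> (nat + nat) \<Rightarrow> nat)" by simp
  have pg: "pair_graph G"
    unfolding G_def H_def
    by (intro pair_graph_relabel[OF inj] pair_graph.pair_graph_subdivide_twice pair_graph_bip)
  then interpret pair_graph G .
  have "\<not> closed_distinguishing_choosable G (t + 3)"
    unfolding G_def H_def
    using not_choosable_subdivide_twice_bip closed_distinguishing_choosable_relabel[OF inj] by blast
  then have "t + 3 < dis_choice G" by (rule dis_choice_greater)
  moreover have "dis G \<le> 2"
    unfolding G_def H_def dis_relabel[OF inj] using assms by (intro dis_subdivide_twice_bip) simp
  ultimately show ?thesis using pg by (intro exI[of _ G]) auto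
qed

end
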